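(* Each submagma of $\mathbb{M}$ is free, and $\mathbb{M}_X$ can be embedded in $\mathbb{M}$ for any countable set $X$. In addition, the set of submagmas $\mathbf{Sub}(\mathbb{M})$ is not countable.
   Context: A magma is a set with a binary operation $+$. A submagma of a magma is a subset closed under $+$ (the empty set is counted as a submagma), and $\mathbf{Sub}(M)$ denotes the set of submagmas of $M$. For a non-empty set $X$, put $X_1=X$ and $X_n=\bigcup_{k=1}^{n-1}X_k\times X_{n-k}$ for $n>1$ (the sets $X_n$ being pairwise disjoint); the free magma on $X$ is $\mathbb{M}_X=\bigcup_{n\ge1}X_n$ with $x+y=(x,y)$. A magma $M$ is free iff there is some set $X$ such that $M\cong\mathbb{M}_X$. $\mathbb{M}=\mathbb{M}_{\{1\}}$ is the free magma on one generator $1$. Embedded means that there is an injective magma homomorphism $\mathbb{M}_X\to\mathbb{M}$. Countable means finite or countably infinite. *)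

theory Defs
  imports "HOL-Library.Countable_Set"
begin

record 'a magma =
  carrier :: "'a set"
  add :: "'a \<Rightarrow> 'a \<Rightarrow> 'a"

definition is_magma :: "'a magma \<Rightarrow> bool" where
  "is_magma M \<longleftrightarrow> (\<forall>x\<in>carrier M. \<forall>y\<in>carrier M. add M x y \<in> carrier M)"

definition Sub :: "'a magma \<Rightarrow> 'a set set" where
  "Sub M = {S. S \<subseteq> carrier M \<and> (\<forall>x\<in>S. \<forall>y\<in>S. add M x y \<in> S)}"

definition restrict_magma :: "'a magma \<Rightarrow> 'a set \<Rightarrow> 'a magma" where
  "restrict_magma M S = M\<lparr>carrier := S\<rparr>"

definition magma_hom :: "'a magma \<Rightarrow> 'b magma \<Rightarrow> ('a \<Rightarrow> 'b) set" where
  "magma_hom M N = {h. h ` carrier M \<subseteq> carrier N \<and>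
     (\<forall>x\<in>carrier M. \<forall>y\<in>carrier M. h (add M x y) = add N (h x) (h y))}"

definition embeds :: "'a magma \<Rightarrow> 'b magma \<Rightarrow> bool" where
  "embeds M N \<longleftrightarrow> (\<exists>h\<in>magma_hom M N. inj_on h (carrier M))"

definition isomorphic :: "'a magma \<Rightarrow> 'b magma \<Rightarrow> bool" where
  "isomorphic M N \<longleftrightarrow> (\<exists>h\<in>magma_hom M N. bij_betw h (carrier M) (carrier N))"

text \<open>The iterated pairs of the construction \<open>X\<^sub>n = \<Union>\<^sub>k X\<^sub>k \<times> X\<^bsub>n-k\<^esub>\<close> do not live in
  a single simple type, so \<open>Join x y\<close> plays the role of the pair \<open>(x, y)\<close> and \<open>Gen\<close> that of the
  inclusion of \<open>X\<^sub>1 = X\<close>. As the constructors are free, the \<open>X\<^sub>n\<close> are pairwise disjoint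
  for every \<open>X\<close>.\<close>

datatype 'a mterm = Gen 'a | Join "'a mterm" "'a mterm"

text \<open>The index \<open>0\<close> is unused: the equation gives the empty set there.\<close>

function level :: "'a set \<Rightarrow> nat \<Rightarrow> 'a mterm set" where
  "level X n = (if n = 1 then Gen ` X
     else (\<Union>k\<in>{1..<n}. {Join x y | x y. x \<in> level X k \<and> y \<in> level X (n - k)}))"
  by pat_completeness auto
termination by (relation "measure snd") auto

declare level.simps [simp del]

text \<open>The empty \<open>X\<close> is allowed and gives the empty magma; the empty submagma is free in this
  sense.\<close>

definition free_magma :: "'a set \<Rightarrow> 'a mterm magma" where
  "free_magma X = \<lparr>carrier = (\<Union>n\<in>{1..}. level X n), add = Join\<rparr>"

lemma level_1: "level X (Suc 0) = Gen ` X"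
  by (subst level.simps) simp

lemma Join_level:
  assumes "x \<in> level X k" "y \<in> level X m" "1 \<le> k" "1 \<le> m"
  shows "Join x y \<in> level X (k + m)"
proof -
  have "k + m \<noteq> 1" "k \<in> {1..<k + m}" "y \<in> level X (k + m - k)" using assms by simp_all
  then show ?thesis using assms(1) by (subst level.simps) auto
qed

lemma set_level: "t \<in> level X n \<Longrightarrow> set_mterm t \<subseteq> X"
proof (induction t arbitrary: n)
  case (Gen a)
  then show ?case by (subst (asm) level.simps) (auto split: if_splits)
next
  case (Join x y)
  from Join.prems obtain k where "x \<in> level X k" "y \<in> level X (n - k)"
    by (subst (asm) level.simps) (auto split: if_splits)
  then show ?case using Join.IH by auto
qed

lemma level_exists: "set_mterm t \<subseteq> X \<Longrightarrow> \<exists>n\<ge>1. t \<in> level X n"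
proof (induction t)
  case (Gen a)
  then show ?case by (intro exI[of _ 1]) (simp add: level_1)
next
  case (Join x y)
  then obtain k m where "k \<ge> 1" "x \<in> level X k" "m \<ge> 1" "y \<in> level X m" by auto
  then show ?case by (intro exI[of _ "k + m"]) (simp add: Join_level)
qed

lemma carrier_free_magma: "carrier (free_magma X) = {t. set_mterm t \<subseteq> X}"
proof (intro equalityI subsetI)
  fix t assume "t \<in> carrier (free_magma X)"
  then obtain n where "t \<in> level X n" by (auto simp: free_magma_def)
  then show "t \<in> {t. set_mterm t \<subseteq> X}" using set_level by blast
next
  fix t assume "t \<in> {t. set_mterm t \<subseteq> X}"
  then obtain n where "n \<ge> 1" "t \<in> level X n" using level_exists by blast
  then show "t \<in> carrier (free_magma X)" by (auto simp: free_magma_def)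
qed

lemma add_free_magma: "add (free_magma X) = Join"
  by (simp add: free_magma_def)

lemma is_magma_free_magma: "is_magma (free_magma X)"
  by (simp add: is_magma_def carrier_free_magma add_free_magma)

text \<open>The generating set is taken in the type of the magma. This loses no generality, since \<open>X\<close>
  injects into the carrier of any magma isomorphic to \<open>free_magma X\<close>; see
  \<open>is_free_if_isomorphic\<close> below.\<close>

definition is_free :: "'a magma \<Rightarrow> bool" where
  "is_free M \<longleftrightarrow> is_magma M \<and> (\<exists>X::'a set. isomorphic M (free_magma X))"

lemma is_free_if_isomorphic:
  fixes M :: "'a magma" and X :: "'b set"
  assumes "is_magma M" "isomorphic M (free_magma X)"
  shows "is_free M"
proof -
  obtain h where h: "h \<in> magma_hom M (free_magma X)"
    and bij: "bij_betw h (carrier M) (carrier (free_magma X))"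
    using assms(2) by (auto simp: isomorphic_def)
  define g where "g = (\<lambda>x. inv_into (carrier M) h (Gen x))"
  have hg: "h (g x) = Gen x" if "x \<in> X" for x
    using that bij by (simp add: g_def bij_betw_inv_into_right carrier_free_magma)
  have inj: "inj_on g X"
    by (rule inj_onI) (metis hg mterm.inject(1))
  have inj': "inj_on (map_mterm g) (carrier (free_magma X))"
  proof (rule inj_onI)
    fix s t assume "s \<in> carrier (free_magma X)" "t \<in> carrier (free_magma X)"
      and eq: "map_mterm g s = map_mterm g t"
    then have "set_mterm s \<subseteq> X" "set_mterm t \<subseteq> X" by (simp_all add: carrier_free_magma)
    with eq inj show "s = t" by (intro mterm.inj_map_strong[of s t g g]) (auto dest: inj_onD)
  qed
  have surj: "map_mterm g ` carrier (free_magma X) = carrier (free_magma (g ` X))"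
  proof (intro equalityI subsetI)
    fix t assume "t \<in> carrier (free_magma (g ` X))"
    then have t: "set_mterm t \<subseteq> g ` X" by (simp add: carrier_free_magma)
    have "map_mterm g (map_mterm (inv_into X g) t) = t"
      using t by (simp add: mterm.map_comp) (rule mterm.map_ident_strong, auto simp: f_inv_into_f)
    moreover have "map_mterm (inv_into X g) t \<in> carrier (free_magma X)"
      using t by (auto simp: carrier_free_magma mterm.set_map inv_into_into)
    ultimately show "t \<in> map_mterm g ` carrier (free_magma X)" by (metis image_eqI)
  qed (force simp: carrier_free_magma mterm.set_map)
  have "map_mterm g \<circ> h \<in> magma_hom M (free_magma (g ` X))"
    using h surj by (auto simp: magma_hom_def add_free_magma)
  moreover have "bij_betw (map_mterm g \<circ> h) (carrier M) (carrier (free_magma (g ` X)))"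
    using bij inj' surj by (auto intro: bij_betw_trans simp: bij_betw_def[of "map_mterm g"])
  ultimately show ?thesis
    using assms(1) by (auto simp: is_free_def isomorphic_def)
qed

end

(* A submagma S of a free magma is freely generated by its elements that are not a sum of two
   elements of S: every element of S decomposes into these by induction on terms, and uniquely so
   because the summands of a term are determined by it.  The non-generators of the free magma on 1
   form a submagma whose indecomposable elements include the infinitely many combs 1 + 1,
   1 + (1 + 1), ...; hence the combs are free generators, and distinct sets of combs generate
   distinct submagmas. *)

theory Submission
  imports Defs
begin

text \<open>The homomorphism that extends the identity on generators, i.e. the multiplication of the
  term monad: the outer term is evaluated in the magma of inner terms.\<close>

primrec flatten :: "'a mterm mterm \<Rightarrow> 'a mterm" where
  "flatten (Gen t) = t"
| "flatten (Join u v) = Join (flatten u) (flatten v)"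

text \<open>A sum in \<open>S\<close> with a summand outside \<open>S\<close> is kept, so the
  generators of a submagma need not have the form \<open>Gen a\<close>.\<close>

definition indecomposables :: "'a mterm set \<Rightarrow> 'a mterm set" where
  "indecomposables S = S - {Join x y | x y. x \<in> S \<and> y \<in> S}"

lemma indecomposables_subset: "indecomposables S \<subseteq> S"
  by (auto simp: indecomposables_def)

lemma Join_notin_indecomposables:
  "x \<in> S \<Longrightarrow> y \<in> S \<Longrightarrow> Join x y \<notin> indecomposables S"
  by (auto simp: indecomposables_def)

lemma flatten_closed:
  assumes "\<And>x y. x \<in> S \<Longrightarrow> y \<in> S \<Longrightarrow> Join x y \<in> S" "set_mterm u \<subseteq> S"
  shows "flatten u \<in> S"
  using assms(2) by (induction u) (auto intro: assms(1))

text \<open>A generator flattens to an indecomposable element, a \<open>Join\<close> to a sum of two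
  elements of \<open>S\<close>. Equal values thus force equal outermost constructors, and
  injectivity of \<open>Join\<close> passes the equality on to the summands.\<close>

lemma inj_on_flatten:
  assumes closed: "\<And>x y. x \<in> S \<Longrightarrow> y \<in> S \<Longrightarrow> Join x y \<in> S"
  shows "inj_on flatten (carrier (free_magma (indecomposables S)))"
proof -
  have mem: "flatten u \<in> S" if "set_mterm u \<subseteq> indecomposables S" for u
    using flatten_closed[OF closed] that indecomposables_subset by blast
  have "u = v" if "flatten u = flatten v" "set_mterm u \<subseteq> indecomposables S"
    "set_mterm v \<subseteq> indecomposables S" for u v
    using that
  proof (induction u arbitrary: v)
    case (Gen t)
    then show ?case by (cases v) (auto simp: mem Join_notin_indecomposables)
  next
    case (Join u1 u2)
    show ?case
    proof (cases v)
      case (Gen t)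
      with Join.prems have "Join (flatten u1) (flatten u2) \<in> indecomposables S" by simp
      moreover have "flatten u1 \<in> S" "flatten u2 \<in> S"
        using Join.prems by (simp_all add: mem)
      ultimately show ?thesis by (simp add: Join_notin_indecomposables)
    next
      case (Join v1 v2)
      with Join.prems Join.IH show ?thesis by simp
    qed
  qed
  then show ?thesis by (auto simp: carrier_free_magma intro: inj_onI)
qed

lemma flatten_onto:
  "t \<in> S \<Longrightarrow> t \<in> flatten ` carrier (free_magma (indecomposables S))"
proof (induction t)
  case (Gen a)
  then show ?case
    by (intro image_eqI[of _ _ "Gen (Gen a)"])
      (auto simp: carrier_free_magma indecomposables_def)
next
  case (Join x y)
  show ?case
  proof (cases "x \<in> S \<and> y \<in> S")
    case True
    with Join.IH obtain u v where "x = flatten u" "y = flatten v"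
      "set_mterm u \<subseteq> indecomposables S" "set_mterm v \<subseteq> indecomposables S"
      by (auto simp: carrier_free_magma)
    then show ?thesis
      by (intro image_eqI[of _ _ "Join u v"]) (auto simp: carrier_free_magma)
  next
    \<comment> \<open>Some summand lies outside \<open>S\<close>, so \<open>Join x y\<close> as a
      whole is a single generator.\<close>
    case False
    with Join.prems show ?thesis
      by (intro image_eqI[of _ _ "Gen (Join x y)"])
        (auto simp: carrier_free_magma indecomposables_def)
  qed
qed

lemma bij_betw_flatten:
  assumes closed: "\<And>x y. x \<in> S \<Longrightarrow> y \<in> S \<Longrightarrow> Join x y \<in> S"
  shows "bij_betw flatten (carrier (free_magma (indecomposables S))) S"
  using inj_on_flatten[OF closed] flatten_onto[of _ S] flatten_closed[OF closed]
    indecomposables_subset[of S]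
  by (auto simp: bij_betw_def carrier_free_magma)

text \<open>Reverses \<open>flatten\<close>, which maps out of the free magma, whereas
  \<open>is_free\<close> asks for a map into it.\<close>

lemma isomorphic_sym:
  assumes "is_magma M" "isomorphic M N"
  shows "isomorphic N M"
proof -
  obtain h where h: "h \<in> magma_hom M N" "bij_betw h (carrier M) (carrier N)"
    using assms(2) by (auto simp: isomorphic_def)
  let ?g = "inv_into (carrier M) h"
  have bij: "bij_betw ?g (carrier N) (carrier M)"
    using h(2) by (rule bij_betw_inv_into)
  have "?g (add N x y) = add M (?g x) (?g y)" if "x \<in> carrier N" "y \<in> carrier N" for x y
  proof -
    have g: "?g x \<in> carrier M" "?g y \<in> carrier M"
      using that bij by (auto dest: bij_betwE)
    then have "h (add M (?g x) (?g y)) = add N x y"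
      using h that by (simp add: magma_hom_def bij_betw_inv_into_right)
    \<comment> \<open>Closure of \<open>M\<close> puts \<open>add M (?g x) (?g y)\<close> into the
      carrier, where \<open>?g\<close> undoes \<open>h\<close>.\<close>
    with g assms(1) h(2) show ?thesis
      by (metis bij_betw_inv_into_left is_magma_def)
  qed
  with bij show ?thesis
    by (auto simp: isomorphic_def magma_hom_def intro!: bexI[of _ ?g] dest: bij_betwE)
qed

lemma is_free_submagma:
  assumes "S \<in> Sub (free_magma X)"
  shows "is_free (restrict_magma (free_magma X) S)"
proof -
  have closed: "Join x y \<in> S" if "x \<in> S" "y \<in> S" for x y
    using assms that by (auto simp: Sub_def add_free_magma)
  let ?F = "free_magma (indecomposables S)" and ?M = "restrict_magma (free_magma X) S"
  have M: "carrier ?M = S" "add ?M = Join"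
    by (simp_all add: restrict_magma_def add_free_magma)
  have bij: "bij_betw flatten (carrier ?F) S"
    using closed by (rule bij_betw_flatten)
  then have "flatten \<in> magma_hom ?F ?M"
    by (auto simp: magma_hom_def M add_free_magma dest: bij_betwE)
  with bij have "isomorphic ?F ?M"
    by (auto simp: isomorphic_def M)
  then have "isomorphic ?M ?F"
    by (rule isomorphic_sym[OF is_magma_free_magma])
  moreover have "is_magma ?M"
    by (simp add: is_magma_def M closed)
  ultimately show ?thesis
    by (auto simp: is_free_def)
qed

text \<open>Index \<open>0\<close> is already a sum of two generators, so every comb lies in
  \<open>- range Gen\<close>.\<close>

primrec comb :: "'a \<Rightarrow> nat \<Rightarrow> 'a mterm" where
  "comb a 0 = Join (Gen a) (Gen a)"
| "comb a (Suc n) = Join (Gen a) (comb a n)"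

lemma set_comb: "set_mterm (comb a n) = {a}"
  by (induction n) auto

lemma Gen_neq_comb [simp]: "Gen b \<noteq> comb a n" "comb a n \<noteq> Gen b"
  by (cases n, simp_all)+

lemma inj_comb: "inj (comb a)"
proof (rule injI)
  fix m n show "comb a m = comb a n \<Longrightarrow> m = n"
  proof (induction m arbitrary: n)
    case 0
    then show ?case by (cases n) auto
  next
    case (Suc m)
    then show ?case by (cases n) auto
  qed
qed

text \<open>The left summand of every comb is \<open>Gen a\<close>, which lies outside
  \<open>- range Gen\<close>.\<close>

lemma comb_indecomposable: "comb a n \<in> indecomposables (- range Gen)"
  by (cases n) (auto simp: indecomposables_def)

text \<open>Part of a free generating set still generates freely: fewer generators only shrink the
  set on which \<open>flatten\<close> is injective.\<close>

lemma inj_on_flatten_combs: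
  "inj_on flatten (carrier (free_magma (range (comb a))))"
proof (rule inj_on_subset)
  show "inj_on flatten (carrier (free_magma (indecomposables (- range Gen))))"
    \<comment> \<open>\<open>- range Gen\<close> is closed because a \<open>Join\<close> is never a
      \<open>Gen\<close>.\<close>
    by (rule inj_on_flatten) auto
  show "carrier (free_magma (range (comb a)))
      \<subseteq> carrier (free_magma (indecomposables (- range Gen)))"
    using comb_indecomposable by (fastforce simp: carrier_free_magma)
qed

lemma flatten_combs_carrier:
  assumes "set_mterm u \<subseteq> range (comb a)"
  shows "flatten u \<in> carrier (free_magma {a})"
proof -
  have "range (comb a) \<subseteq> carrier (free_magma {a})"
    by (auto simp: carrier_free_magma set_comb)
  with assms show ?thesis
    by (intro flatten_closed) (auto simp: carrier_free_magma)
qed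

lemma embeds_free_magma_singleton:
  assumes "countable X"
  shows "embeds (free_magma X) (free_magma {a})"
proof -
  \<comment> \<open>Countability makes \<open>to_nat_on X\<close> injective on \<open>X\<close>,
    finite or infinite, so distinct elements of \<open>X\<close> go to distinct combs.\<close>
  define g where "g = comb a \<circ> to_nat_on X"
  have g: "inj_on g X"
    unfolding g_def
    by (intro comp_inj_on inj_on_to_nat_on assms inj_on_subset[OF inj_comb]) simp
  have range: "set_mterm (map_mterm g t) \<subseteq> range (comb a)" for t
    by (auto simp: mterm.set_map g_def)
  have "s = t" if "set_mterm s \<subseteq> X" "set_mterm t \<subseteq> X"
    "flatten (map_mterm g s) = flatten (map_mterm g t)" for s t
  proof -
    have "map_mterm g s = map_mterm g t"
      using inj_on_flatten_combs that(3)
      by (rule inj_onD) (use range in \<open>auto simp: carrier_free_magma\<close>)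
    \<comment> \<open>As \<open>g\<close> is injective only on \<open>X\<close>, the strong rule is
      used, which compares only labels that occur in \<open>s\<close> and \<open>t\<close>.\<close>
    with g that(1,2) show ?thesis
      by (intro mterm.inj_map_strong[of s t g g]) (auto dest: inj_onD)
  qed
  then have "inj_on (flatten \<circ> map_mterm g) (carrier (free_magma X))"
    by (auto simp: carrier_free_magma intro: inj_onI)
  moreover have "flatten \<circ> map_mterm g \<in> magma_hom (free_magma X) (free_magma {a})"
    using flatten_combs_carrier[OF range] by (auto simp: magma_hom_def add_free_magma)
  ultimately show ?thesis
    by (auto simp: embeds_def)
qed

lemma uncountable_nat_sets: "\<not> countable (UNIV :: nat set set)"
proof
  assume "countable (UNIV :: nat set set)"
  \<comment> \<open>A countable power set would be enumerated by \<open>nat\<close>, against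
    Cantor.\<close>
  then have "range (from_nat_into (UNIV :: nat set set)) = Pow UNIV"
    by (simp add: range_from_nat_into)
  then show False
    using Cantors_theorem by blast
qed

lemma uncountable_Sub: "\<not> countable (Sub (free_magma {a}))"
proof -
  \<comment> \<open>The submagma generated by the combs with index in \<open>A\<close>; the combs it
    contains determine \<open>A\<close>.\<close>
  define gen where "gen A = flatten ` carrier (free_magma (comb a ` A))" for A
  have iff: "comb a n \<in> gen A \<longleftrightarrow> n \<in> A" for n A
  proof
    assume "comb a n \<in> gen A"
    \<comment> \<open>Writing \<open>comb a n\<close> as a flattened generator lets injectivity of
      \<open>flatten\<close> over all combs identify that generator with \<open>u\<close>, whose
      labels have indices in \<open>A\<close>.\<close>
    then obtain u where u: "set_mterm u \<subseteq> comb a ` A" "flatten (Gen (comb a n)) = flatten u"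
      by (auto simp: gen_def carrier_free_magma)
    then have "Gen (comb a n) = u"
      by (intro inj_onD[OF inj_on_flatten_combs[of a]]) (auto simp: carrier_free_magma simp del: flatten.simps)
    with u(1) show "n \<in> A"
      using inj_comb[of a] by (auto dest: injD)
  next
    assume "n \<in> A"
    then show "comb a n \<in> gen A"
      unfolding gen_def
      by (intro image_eqI[of _ _ "Gen (comb a n)"]) (auto simp: carrier_free_magma)
  qed
  have "inj gen"
    by (rule injI) (metis iff set_eqI)
  moreover have "gen A \<in> Sub (free_magma {a})" for A
  proof -
    have "gen A \<subseteq> carrier (free_magma {a})"
    proof
      fix t assume "t \<in> gen A"
      then obtain u where "t = flatten u" "set_mterm u \<subseteq> comb a ` A"
        by (auto simp: gen_def carrier_free_magma)
      then show "t \<in> carrier (free_magma {a})"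
        using flatten_combs_carrier[of u a] by blast
    qed
    moreover have "Join x y \<in> gen A" if xy: "x \<in> gen A" "y \<in> gen A" for x y
    proof -
      obtain u v where "x = flatten u" "y = flatten v"
        "set_mterm u \<subseteq> comb a ` A" "set_mterm v \<subseteq> comb a ` A"
        using xy by (auto simp: gen_def carrier_free_magma)
      then show ?thesis
        unfolding gen_def
        by (intro image_eqI[of _ _ "Join u v"]) (auto simp: carrier_free_magma)
    qed
    ultimately show ?thesis
      by (simp add: Sub_def add_free_magma)
  qed
  then have "range gen \<subseteq> Sub (free_magma {a})"
    by (rule image_subsetI)
  ultimately show ?thesis
    by (metis countable_image_inj_on countable_subset uncountable_nat_sets)
qed

theorem theorem4p12:
  shows "(\<forall>S \<in> Sub (free_magma {1::nat}). is_free (restrict_magma (free_magma {1}) S)) \<and>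
    (\<forall>X::'b set. countable X \<longrightarrow> embeds (free_magma X) (free_magma {1::nat})) \<and>
    \<not> countable (Sub (free_magma {1::nat}))"
  by (simp add: is_free_submagma embeds_free_magma_singleton uncountable_Sub)

end
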